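(* Let $f:I_0\times\Theta\to I_1$ and $g:I_1\times\Theta\to I_0$, $\Theta\subset\mathbb{R}^3$, be the two families of maps of an alternating system, and let $F=g\circ f$. Let $\Lambda_0\in\Theta$, $a\in I_0$ and $b=f(a,\Lambda_0)\in I_1$ satisfy all the conditions of the $A_3$ (swallowtail) bifurcation, together with the transversality condition: $$F(a,\Lambda_0)=a,\quad F_x(a,\Lambda_0)=1,\quad F_{xx}(a,\Lambda_0)=0,\quad F_{xxx}(a,\Lambda_0)=0,\quad F_{x^4}(a,\Lambda_0)\neq0,$$ $$\det\begin{bmatrix} F_{\lambda_1} & F_{\lambda_2} & F_{\lambda_3} \\ F_{x\lambda_1} & F_{x\lambda_2} & F_{x\lambda_3} \\ F_{xx\lambda_1} & F_{xx\lambda_2} & F_{xx\lambda_3} \end{bmatrix}(a,\Lambda_0)\neq0.$$ If one of the maps, say without loss of generality $g$, has Schwarzian derivative different from zero at the bifurcation point, $Sg(b)\neq0$, then the product of the Schwarzian derivatives is negative at the swallowtail bifurcation point: $$Sg(b)\cdot Sf(a)<0.$$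
   Context: $I_0,I_1$ are real intervals, $\Theta\subset\mathbb{R}^3$ is an open parameter set with parameter $\Lambda=(\lambda_1,\lambda_2,\lambda_3)$, and $f(I_0,\Lambda)\subseteq I_1$, $g(I_1,\Lambda)\subseteq I_0$ for all $\Lambda\in\Theta$. Both $f$ and $g$ are $\mathcal{C}^4$ in the dynamic variable $x$ and $\mathcal{C}^1$ in $\Lambda$, in the sense that $\partial_{x^l}$ ($0\le l\le4$) and $\partial_{x^l}\partial_{\lambda_r}$ ($0\le l\le2$, $1\le r\le3$) of $f$ and $g$ exist and are continuous in $(x,\Lambda)$. Compositions are in the dynamic variable only: $(g\circ f)(x,\Lambda)=g(f(x,\Lambda),\Lambda)$. Subscripts denote partial derivatives. The Schwarzian derivative of a $\mathcal{C}^3$ function $u$ of the dynamic variable, at a point $x$ with $u'(x)\neq0$, is $$Su(x)=\frac{u'''(x)}{u'(x)}-\frac32\left(\frac{u''(x)}{u'(x)}\right)^2.$$ $Sf(a)$ and $Sg(b)$ are computed for $f(\cdot,\Lambda_0)$ and $g(\cdot,\Lambda_0)$, with derivatives in $x$. *)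

theory Defs
  imports "HOL-Analysis.Analysis"
begin

text \<open>
  Maps depending on parameters are curried: \<open>u x \<Lambda>\<close>, with \<open>x\<close> the dynamic variable. They are total
  functions, but only their values for \<open>x\<close> in a given interval and \<open>\<Lambda>\<close> in the parameter set
  matter. Intervals may contain their endpoints; derivatives in \<open>x\<close> are therefore taken within
  the interval (one-sided at an endpoint).
\<close>

definition nondegenerate_interval :: "real set \<Rightarrow> bool" where
  "nondegenerate_interval I \<longleftrightarrow> is_interval I \<and> interior I \<noteq> {}"

definition deriv_on :: "real set \<Rightarrow> (real \<Rightarrow> real) \<Rightarrow> real \<Rightarrow> real" where
  "deriv_on I u x = vector_derivative u (at x within I)"

definition schwarzian_on :: "real set \<Rightarrow> (real \<Rightarrow> real) \<Rightarrow> real \<Rightarrow> real" where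
  "schwarzian_on I u x =
     (deriv_on I ^^ 3) u x / deriv_on I u x
       - 3 / 2 * ((deriv_on I ^^ 2) u x / deriv_on I u x)\<^sup>2"

definition partial_x ::
    "real set \<Rightarrow> nat \<Rightarrow> (real \<Rightarrow> real ^ 3 \<Rightarrow> real) \<Rightarrow> real \<Rightarrow> real ^ 3 \<Rightarrow> real" where
  "partial_x I l u x \<Lambda> = (deriv_on I ^^ l) (\<lambda>y. u y \<Lambda>) x"

definition partial_lam ::
    "3 \<Rightarrow> (real \<Rightarrow> real ^ 3 \<Rightarrow> real) \<Rightarrow> real \<Rightarrow> real ^ 3 \<Rightarrow> real" where
  "partial_lam r u x \<Lambda> = vector_derivative (\<lambda>t. u x (\<Lambda> + t *\<^sub>R axis r 1)) (at 0)"

text \<open>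
  The mixed derivative \<open>\<partial>\<^bsub>x^l\<^esub> \<partial>\<^bsub>\<lambda>_r\<^esub> u\<close> is formed in the order in which the operators are written,
  first in \<open>\<lambda>_r\<close> and then \<open>l\<close> times in \<open>x\<close>. Under the regularity assumed below the order is
  immaterial.
\<close>

definition partial_x_lam ::
    "real set \<Rightarrow> nat \<Rightarrow> 3 \<Rightarrow> (real \<Rightarrow> real ^ 3 \<Rightarrow> real) \<Rightarrow> real \<Rightarrow> real ^ 3 \<Rightarrow> real" where
  "partial_x_lam I l r u = partial_x I l (partial_lam r u)"

definition C4_C1_family ::
    "real set \<Rightarrow> (real ^ 3) set \<Rightarrow> (real \<Rightarrow> real ^ 3 \<Rightarrow> real) \<Rightarrow> bool" where
  "C4_C1_family I \<Theta> u \<longleftrightarrow>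
     (\<forall>l<4. \<forall>x\<in>I. \<forall>\<Lambda>\<in>\<Theta>. (\<lambda>y. partial_x I l u y \<Lambda>) differentiable (at x within I)) \<and>
     (\<forall>l\<le>4. continuous_on (I \<times> \<Theta>) (\<lambda>(x, \<Lambda>). partial_x I l u x \<Lambda>)) \<and>
     (\<forall>r. \<forall>x\<in>I. \<forall>\<Lambda>\<in>\<Theta>. (\<lambda>t. u x (\<Lambda> + t *\<^sub>R axis r 1)) differentiable (at 0)) \<and>
     (\<forall>r. \<forall>l<2. \<forall>x\<in>I. \<forall>\<Lambda>\<in>\<Theta>.
        (\<lambda>y. partial_x_lam I l r u y \<Lambda>) differentiable (at x within I)) \<and>
     (\<forall>r. \<forall>l\<le>2. continuous_on (I \<times> \<Theta>) (\<lambda>(x, \<Lambda>). partial_x_lam I l r u x \<Lambda>))"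

definition alternating_system ::
    "real set \<Rightarrow> real set \<Rightarrow> (real ^ 3) set \<Rightarrow>
     (real \<Rightarrow> real ^ 3 \<Rightarrow> real) \<Rightarrow> (real \<Rightarrow> real ^ 3 \<Rightarrow> real) \<Rightarrow> bool" where
  "alternating_system I0 I1 \<Theta> f g \<longleftrightarrow>
     nondegenerate_interval I0 \<and> nondegenerate_interval I1 \<and> open \<Theta> \<and>
     (\<forall>\<Lambda>\<in>\<Theta>. (\<lambda>x. f x \<Lambda>) ` I0 \<subseteq> I1 \<and> (\<lambda>x. g x \<Lambda>) ` I1 \<subseteq> I0) \<and>
     C4_C1_family I0 \<Theta> f \<and> C4_C1_family I1 \<Theta> g"

definition dyn_comp ::
    "(real \<Rightarrow> real ^ 3 \<Rightarrow> real) \<Rightarrow> (real \<Rightarrow> real ^ 3 \<Rightarrow> real) \<Rightarrow> real \<Rightarrow> real ^ 3 \<Rightarrow> real" where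
  "dyn_comp g f = (\<lambda>x \<Lambda>. g (f x \<Lambda>) \<Lambda>)"

end

theory Submission
  imports Defs
begin

text \<open>
  The Schwarzian derivative is a cocycle for composition:
  \<open>S(g \<circ> f)(a) = Sg(b) \<cdot> f'(a)\<^sup>2 + Sf(a)\<close> with \<open>b = f(a)\<close> (lemma \<open>schwarzian_on_compose\<close>). At a swallowtail
  point \<open>F = g \<circ> f\<close> agrees with the identity to third order, so \<open>F\<close> has Schwarzian derivative zero
  there, and hence \<open>Sf(a) = - Sg(b) \<cdot> f'(a)\<^sup>2\<close>. Moreover \<open>g'(b) \<cdot> f'(a) = F'(a) = 1\<close> forces \<open>f'(a) \<noteq> 0\<close>.
  Therefore \<open>Sf(a)\<close> and \<open>Sg(b)\<close> vanish together, and if one of them does not vanish, then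
  \<open>Sg(b) \<cdot> Sf(a) = - (Sg(b) \<cdot> f'(a))\<^sup>2 < 0\<close>.

  The cocycle identity follows from the formulas for the first three derivatives of a composition.
  As derivatives are taken within an interval, these formulas have to hold at every point of the
  interval before they can be differentiated once more.
\<close>

lemma nondegenerate_interval_islimpt:
  assumes "nondegenerate_interval I" and "x \<in> I"
  shows "x islimpt I"
proof (rule connected_imp_perfect)
  show "connected I"
    using assms(1) by (simp add: nondegenerate_interval_def is_interval_connected_1)
  show "I \<noteq> {y}" for y
    using assms(1) by (auto simp: nondegenerate_interval_def)
qed (rule assms(2))

lemma deriv_on_eqI:
  assumes "x islimpt I" and "(u has_field_derivative d) (at x within I)"
  shows "deriv_on I u x = d"
  using assms unfolding deriv_on_def
  by (intro vector_derivative_within)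
     (auto simp: trivial_limit_within has_real_derivative_iff_has_vector_derivative)

lemma has_field_derivative_deriv_on:
  assumes "u differentiable (at x within I)"
  shows "(u has_field_derivative deriv_on I u x) (at x within I)"
  using assms
  by (simp add: deriv_on_def has_real_derivative_iff_has_vector_derivative
      vector_derivative_works[symmetric])

text \<open>
  Iterated derivatives within \<open>I\<close> are determined by the values on \<open>I\<close> alone, which makes it
  possible to replace a derivative by a formula that holds on \<open>I\<close> and to differentiate that formula.
\<close>

lemma deriv_on_eqI_on:
  assumes "x islimpt I" and "x \<in> I" and "\<And>y. y \<in> I \<Longrightarrow> u y = v y"
    and "(v has_field_derivative d) (at x within I)"
  shows "deriv_on I u x = d"
proof (rule deriv_on_eqI[OF assms(1)])
  show "(u has_field_derivative d) (at x within I)"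
    using has_field_derivative_transform_within[OF assms(4) zero_less_one assms(2)] assms(3)
    by simp
qed

lemma higher_chain_rule_on:
  fixes f g :: "real \<Rightarrow> real"
  assumes lim: "\<And>x. x \<in> I \<Longrightarrow> x islimpt I"
    and maps: "f ` I \<subseteq> J"
    and f: "\<And>l x. l < 3 \<Longrightarrow> x \<in> I \<Longrightarrow> (deriv_on I ^^ l) f differentiable (at x within I)"
    and g: "\<And>l y. l < 3 \<Longrightarrow> y \<in> J \<Longrightarrow> (deriv_on J ^^ l) g differentiable (at y within J)"
    and x: "x \<in> I"
  defines "f1 \<equiv> deriv_on I f" and "f2 \<equiv> (deriv_on I ^^ 2) f" and "f3 \<equiv> (deriv_on I ^^ 3) f"
    and "g1 \<equiv> deriv_on J g" and "g2 \<equiv> (deriv_on J ^^ 2) g" and "g3 \<equiv> (deriv_on J ^^ 3) g"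
  shows deriv_on_compose: "deriv_on I (\<lambda>x. g (f x)) x = g1 (f x) * f1 x"
    and deriv_on_2_compose:
      "(deriv_on I ^^ 2) (\<lambda>x. g (f x)) x = g2 (f x) * (f1 x)\<^sup>2 + g1 (f x) * f2 x"
    and deriv_on_3_compose:
      "(deriv_on I ^^ 3) (\<lambda>x. g (f x)) x
         = g3 (f x) * f1 x ^ 3 + 3 * g2 (f x) * f1 x * f2 x + g1 (f x) * f3 x"
proof -
  have f': "(f has_field_derivative f1 x) (at x within I)"
      "(f1 has_field_derivative f2 x) (at x within I)"
      "(f2 has_field_derivative f3 x) (at x within I)" if "x \<in> I" for x
    using that f[of 0 x] f[of 1 x] f[of 2 x]
    by (auto dest!: has_field_derivative_deriv_on
        simp: f1_def f2_def f3_def numeral_2_eq_2 numeral_3_eq_3)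
  have g': "(g has_field_derivative g1 y) (at y within J)"
      "(g1 has_field_derivative g2 y) (at y within J)"
      "(g2 has_field_derivative g3 y) (at y within J)" if "y \<in> J" for y
    using that g[of 0 y] g[of 1 y] g[of 2 y]
    by (auto dest!: has_field_derivative_deriv_on
        simp: g1_def g2_def g3_def numeral_2_eq_2 numeral_3_eq_3)
  have chain: "((\<lambda>x. h (f x)) has_field_derivative h' * f1 x) (at x within I)"
    if "(h has_field_derivative h') (at (f x) within J)" "x \<in> I" for h h' x
    using DERIV_image_chain[OF DERIV_subset[OF that(1) maps] f'(1)[OF that(2)]]
    by (simp add: o_def)
  have gf: "((\<lambda>x. g (f x)) has_field_derivative g1 (f x) * f1 x) (at x within I)"
      "((\<lambda>x. g1 (f x)) has_field_derivative g2 (f x) * f1 x) (at x within I)"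
      "((\<lambda>x. g2 (f x)) has_field_derivative g3 (f x) * f1 x) (at x within I)" if "x \<in> I" for x
    using that maps by (auto intro!: chain g')
  have 1: "deriv_on I (\<lambda>x. g (f x)) x = g1 (f x) * f1 x" if "x \<in> I" for x
    using deriv_on_eqI[OF lim gf(1)] that by blast
  have 2: "(deriv_on I ^^ 2) (\<lambda>x. g (f x)) x = g2 (f x) * (f1 x)\<^sup>2 + g1 (f x) * f2 x"
    if "x \<in> I" for x
  proof -
    have "((\<lambda>x. g1 (f x) * f1 x) has_field_derivative g2 (f x) * (f1 x)\<^sup>2 + g1 (f x) * f2 x)
            (at x within I)"
      using that by (auto intro!: derivative_eq_intros gf f' simp: power2_eq_square algebra_simps)
    from deriv_on_eqI_on[OF lim _ 1 this] that show ?thesis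
      by (simp add: numeral_2_eq_2)
  qed
  have 3: "(deriv_on I ^^ 3) (\<lambda>x. g (f x)) x
      = g3 (f x) * f1 x ^ 3 + 3 * g2 (f x) * f1 x * f2 x + g1 (f x) * f3 x" if "x \<in> I" for x
  proof -
    have "((\<lambda>x. g2 (f x) * (f1 x)\<^sup>2 + g1 (f x) * f2 x) has_field_derivative
             g3 (f x) * f1 x ^ 3 + 3 * g2 (f x) * f1 x * f2 x + g1 (f x) * f3 x) (at x within I)"
      using that
      by (auto intro!: derivative_eq_intros gf f'
          simp: power2_eq_square power3_eq_cube algebra_simps)
    from deriv_on_eqI_on[OF lim _ 2 this] that show ?thesis
      by (simp add: numeral_3_eq_3 numeral_2_eq_2)
  qed
  show "deriv_on I (\<lambda>x. g (f x)) x = g1 (f x) * f1 x"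
    and "(deriv_on I ^^ 2) (\<lambda>x. g (f x)) x = g2 (f x) * (f1 x)\<^sup>2 + g1 (f x) * f2 x"
    and "(deriv_on I ^^ 3) (\<lambda>x. g (f x)) x
         = g3 (f x) * f1 x ^ 3 + 3 * g2 (f x) * f1 x * f2 x + g1 (f x) * f3 x"
    using 1 2 3 x by blast+
qed

text \<open>
  Write \<open>f\<^sub>i\<close>, \<open>g\<^sub>i\<close> for the \<open>i\<close>-th derivatives at \<open>x\<close> and \<open>f x\<close>. By the chain rules the quotients of the
  second and the third derivative of the composition by its first are \<open>q f\<^sub>1 + p\<close> with \<open>q = g\<^sub>2/g\<^sub>1\<close>,
  \<open>p = f\<^sub>2/f\<^sub>1\<close>, and \<open>(g\<^sub>3/g\<^sub>1) f\<^sub>1\<^sup>2 + 3 q f\<^sub>2 + f\<^sub>3/f\<^sub>1\<close>. The factor \<open>3/2\<close> in the Schwarzian derivative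
  is the one for which the mixed term \<open>3 q f\<^sub>2\<close> cancels against that of the square.
\<close>

lemma schwarzian_on_compose:
  fixes f g :: "real \<Rightarrow> real"
  assumes "\<And>x. x \<in> I \<Longrightarrow> x islimpt I"
    and "f ` I \<subseteq> J"
    and "\<And>l x. l < 3 \<Longrightarrow> x \<in> I \<Longrightarrow> (deriv_on I ^^ l) f differentiable (at x within I)"
    and "\<And>l y. l < 3 \<Longrightarrow> y \<in> J \<Longrightarrow> (deriv_on J ^^ l) g differentiable (at y within J)"
    and "x \<in> I"
    and "deriv_on I f x \<noteq> 0" and "deriv_on J g (f x) \<noteq> 0"
  shows "schwarzian_on I (\<lambda>x. g (f x)) x
    = schwarzian_on J g (f x) * (deriv_on I f x)\<^sup>2 + schwarzian_on I f x"
  using assms(6,7)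
  by (simp add: schwarzian_on_def higher_chain_rule_on[OF assms(1-5)]
      field_simps power2_eq_square power3_eq_cube)

theorem proposition4p1:
  fixes I0 I1 :: "real set" and \<Theta> :: "(real ^ 3) set"
    and f g F :: "real \<Rightarrow> real ^ 3 \<Rightarrow> real"
    and \<Lambda>0 :: "real ^ 3" and a b :: real
  assumes "alternating_system I0 I1 \<Theta> f g"
    and "F = dyn_comp g f"
    and "\<Lambda>0 \<in> \<Theta>" and "a \<in> I0" and "b = f a \<Lambda>0"
    and "F a \<Lambda>0 = a"
    and "partial_x I0 1 F a \<Lambda>0 = 1"
    and "partial_x I0 2 F a \<Lambda>0 = 0"
    and "partial_x I0 3 F a \<Lambda>0 = 0"
    and "partial_x I0 4 F a \<Lambda>0 \<noteq> 0"
    and "det (vector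
          [vector [partial_lam 1 F a \<Lambda>0, partial_lam 2 F a \<Lambda>0, partial_lam 3 F a \<Lambda>0],
           vector [partial_x_lam I0 1 1 F a \<Lambda>0, partial_x_lam I0 1 2 F a \<Lambda>0,
                   partial_x_lam I0 1 3 F a \<Lambda>0],
           vector [partial_x_lam I0 2 1 F a \<Lambda>0, partial_x_lam I0 2 2 F a \<Lambda>0,
                   partial_x_lam I0 2 3 F a \<Lambda>0]] :: real ^ 3 ^ 3) \<noteq> 0"
    and "schwarzian_on I1 (\<lambda>y. g y \<Lambda>0) b \<noteq> 0 \<or> schwarzian_on I0 (\<lambda>x. f x \<Lambda>0) a \<noteq> 0"
  shows "schwarzian_on I1 (\<lambda>y. g y \<Lambda>0) b * schwarzian_on I0 (\<lambda>x. f x \<Lambda>0) a < 0"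
proof -
  let ?f = "\<lambda>x. f x \<Lambda>0" and ?g = "\<lambda>y. g y \<Lambda>0"
  have lim: "x islimpt I0" if "x \<in> I0" for x
    using assms(1) that by (auto simp: alternating_system_def intro: nondegenerate_interval_islimpt)
  have maps: "?f ` I0 \<subseteq> I1"
    using assms(1,3) by (auto simp: alternating_system_def)
  have f: "(deriv_on I0 ^^ l) ?f differentiable (at x within I0)" if "l < 3" "x \<in> I0" for l x
    using assms(1,3) that unfolding alternating_system_def C4_C1_family_def partial_x_def by force
  have g: "(deriv_on I1 ^^ l) ?g differentiable (at y within I1)" if "l < 3" "y \<in> I1" for l y
    using assms(1,3) that unfolding alternating_system_def C4_C1_family_def partial_x_def by force
  have F: "deriv_on I0 (\<lambda>x. ?g (?f x)) a = 1" "(deriv_on I0 ^^ 2) (\<lambda>x. ?g (?f x)) a = 0"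
      "(deriv_on I0 ^^ 3) (\<lambda>x. ?g (?f x)) a = 0"
    using assms(7-9) by (simp_all add: assms(2) dyn_comp_def partial_x_def)
  have "deriv_on I1 ?g b * deriv_on I0 ?f a = 1"
    using F(1) deriv_on_compose[OF lim maps f g assms(4)] by (simp add: assms(5))
  then have nz: "deriv_on I0 ?f a \<noteq> 0" "deriv_on I1 ?g b \<noteq> 0"
    by auto
  have "schwarzian_on I0 (\<lambda>x. ?g (?f x)) a = 0"
    using F by (simp add: schwarzian_on_def)
  moreover have "schwarzian_on I0 (\<lambda>x. ?g (?f x)) a
      = schwarzian_on I1 ?g b * (deriv_on I0 ?f a)\<^sup>2 + schwarzian_on I0 ?f a"
    using schwarzian_on_compose[OF lim maps f g assms(4)] nz by (simp add: assms(5))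
  ultimately have Sf: "schwarzian_on I0 ?f a = - (schwarzian_on I1 ?g b * (deriv_on I0 ?f a)\<^sup>2)"
    by simp
  then have "schwarzian_on I1 ?g b \<noteq> 0"
    using assms(12) by auto
  with nz have "(schwarzian_on I1 ?g b * deriv_on I0 ?f a)\<^sup>2 > 0"
    by simp
  then show ?thesis
    unfolding Sf by (simp add: power2_eq_square algebra_simps)
qed

end
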